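(* Let $S$ be a reflection symmetric point set with $|S|=k$ ($k\geq 3$) and pivot at the point $s_0$. The Fermat-Weber point of any set $T\in\mathcal{A}(S)$ coincides with the pivot point $s_0$ if and only if the Fermat-Weber point of $S$ coincides with $s_0$, that is, if and only if $S$ satisfies Condition A.
   Context: The Fermat-Weber point of a finite set $S=\{p_1,\dots,p_r\}$ of points in the plane $\mathbb{R}^2$ is the point $p\in\mathbb{R}^2$ minimizing $\sum_{i=1}^r d(p,p_i)$, where $d$ is the Euclidean distance; it is unique when the points of $S$ are not all collinear. A set $S$ of $k=2m+1$ ($m\ge 1$) points in the plane lying on the circumference of a unit circle with center $o$ is reflection symmetric if there exists a point $s_0\in S$ such that for every $s_i\in S\setminus\{s_0\}$, which lies in one of the two open halfplanes determined by the line $os_0$, the reflection $s_i'$ of $s_i$ about the line $os_0$ (lying in the other open halfplane) belongs to $S\setminus\{s_0,s_i\}$. The point $s_0$ is called the pivot of $S$ (a reflection symmetric set is considered together with its pivot). Choose rectangular coordinates with origin $o$ and horizontal axis along $os_0$, so that $s_0=(1,0)$; then $S=\{s_0,s_1,\dots,s_m,s_1',\dots,s_m'\}$ with $s_i=(\cos\theta_i,\sin\theta_i)$, $s_i'=(\cos\theta_i,-\sin\theta_i)$ and $0<\theta_i<\pi$ for $i=1,\dots,m$. The set $S$ satisfies Condition A if $2\sum_{i=1}^m\sin(\theta_i/2)-1\le 0$. The extension $\mathcal{A}(S)$ of $S$ is the set of all $k$-element point sets obtained from $S$ by keeping $s_0$ fixed and moving each point $s\in S\setminus\{s_0\}$ along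 the ray starting at $s_0$ and passing through $s$ (to a point of that ray different from $s_0$), i.e. all sets $\{s_0\}\cup\{s_0+t_s(s-s_0): s\in S\setminus\{s_0\}\}$ with $t_s>0$. The point $s_0$ belongs to every $T\in\mathcal{A}(S)$ and is called the pivot point of $\mathcal{A}(S)$. *)

theory Defs
  imports "HOL-Analysis.Analysis"
begin

definition distance_sum :: "(real^2) set \<Rightarrow> real^2 \<Rightarrow> real" where
  "distance_sum S p = (\<Sum>s\<in>S. dist p s)"

text \<open>For a non-collinear finite set the minimizer exists and is unique
  (\<open>fermat_weber_ex1\<close> below), so the choice made by \<^const>\<open>arg_min\<close> is immaterial.\<close>

definition fermat_weber_point :: "(real^2) set \<Rightarrow> real^2" where
  "fermat_weber_point S = (ARG_MIN (distance_sum S) p. True)"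

lemma fermat_weber_ex1:
  assumes fin: "finite S" and nc: "\<not> collinear S"
  shows "\<exists>!p. is_arg_min (distance_sum S) (\<lambda>_. True) p"
proof -
  from nc obtain a where a: "a \<in> S" by (metis collinear_empty ex_in_conv)
  let ?f = "distance_sum S"
  let ?B = "cball a (?f a)"
  have ge: "dist q a \<le> ?f q" for q
    unfolding distance_sum_def using fin a
    by (intro member_le_sum) auto
  have fa0: "0 \<le> ?f a" using ge[of a] by simp
  have "continuous_on ?B ?f"
    unfolding distance_sum_def by (intro continuous_intros)
  then obtain p where p: "p \<in> ?B" "\<And>q. q \<in> ?B \<Longrightarrow> ?f p \<le> ?f q"
    using continuous_attains_inf[of ?B ?f] fa0 by auto
  have "?f p \<le> ?f q" for q
  proof (cases "q \<in> ?B")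
    case True then show ?thesis using p by simp
  next
    case False
    then have "?f a < dist q a" by (simp add: dist_commute)
    moreover have "?f p \<le> ?f a" using p(2)[of a] fa0 by simp
    ultimately show ?thesis using ge[of q] by linarith
  qed
  then have ex: "is_arg_min ?f (\<lambda>_. True) p"
    by (auto simp: is_arg_min_linorder)
  have "x = y" if x: "\<And>q. ?f x \<le> ?f q" and y: "\<And>q. ?f y \<le> ?f q" for x y
  proof (rule ccontr)
    assume ne: "x \<noteq> y"
    let ?m = "midpoint x y"
    have le: "dist ?m s \<le> (dist x s + dist y s) / 2" for s
    proof -
      have "?m - s = (1/2) *\<^sub>R ((x - s) + (y - s))"
        by (simp add: midpoint_def scaleR_add_right scaleR_diff_right
            flip: scaleR_add_left)
      then show ?thesis
        using norm_triangle_ineq[of "x - s" "y - s"] by (simp add: dist_norm)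
    qed
    have "(\<Sum>s\<in>S. (dist x s + dist y s) / 2) = (?f x + ?f y) / 2"
      by (simp add: distance_sum_def sum.distrib flip: sum_divide_distrib)
    also have "\<dots> \<le> ?f ?m"
      using add_mono[OF x[of ?m] y[of ?m]] by simp
    finally have "(\<Sum>s\<in>S. (dist x s + dist y s) / 2) \<le> (\<Sum>s\<in>S. dist ?m s)"
      by (simp add: distance_sum_def)
    with sum_mono[of S "dist ?m" "\<lambda>s. (dist x s + dist y s) / 2"] le
    have sumeq: "(\<Sum>s\<in>S. dist ?m s) = (\<Sum>s\<in>S. (dist x s + dist y s) / 2)"
      by (meson order_antisym)
    have eq: "dist ?m s = (dist x s + dist y s) / 2" if "s \<in> S" for s
      using sum_mono_inv[OF sumeq _ that fin] le by blast
    have "s \<in> affine hull {x, y}" if s: "s \<in> S" for s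
    proof -
      have "?m - s = (1/2) *\<^sub>R ((x - s) + (y - s))"
        by (simp add: midpoint_def scaleR_add_right scaleR_diff_right
            flip: scaleR_add_left)
      then have "norm ((x - s) + (y - s)) = norm (x - s) + norm (y - s)"
        using eq[OF s] by (simp add: dist_norm)
      then have "collinear {0, x - s, y - s}"
        by (rule norm_triangle_eq_imp_collinear)
      then have "collinear {x, s, y}"
        using collinear_3 by auto
      then show ?thesis
        using ne by (metis collinear_3_affine_hull insert_commute)
    qed
    then have "S \<subseteq> affine hull {x, y}" by blast
    then have "collinear S"
      using collinear_affine_hull by auto
    with nc show False ..
  qed
  then show ?thesis using ex
    by (auto simp: is_arg_min_linorder)
qed

definition reflect_about :: "real^2 \<Rightarrow> real^2 \<Rightarrow> real^2 \<Rightarrow> real^2" where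
  "reflect_about a b x =
     a + (2 * ((x - a) \<bullet> (b - a)) / ((b - a) \<bullet> (b - a))) *\<^sub>R (b - a) - (x - a)"

text \<open>A point off the line lies in one of the two open halfplanes which the line determines.\<close>

definition reflection_symmetric :: "real^2 \<Rightarrow> real^2 \<Rightarrow> (real^2) set \<Rightarrow> bool" where
  "reflection_symmetric c s0 S \<longleftrightarrow>
     (\<exists>m\<ge>1. card S = 2 * m + 1) \<and> S \<subseteq> sphere c 1 \<and> s0 \<in> S \<and>
     (\<forall>s \<in> S - {s0}. s \<notin> affine hull {c, s0} \<and> reflect_about c s0 s \<in> S - {s0, s})"

text \<open>The rectangular coordinates with origin \<open>c\<close> in which \<open>s0\<close> is \<open>(1,0)\<close> have the axes
  \<open>s0 - c\<close> and \<open>rot90 (s0 - c)\<close>. The points \<open>s\<^sub>1,\<dots>,s\<^sub>m\<close> are those of the open upper halfplane;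
  taking the other orientation exchanges them with their mirror images and leaves the
  angles unchanged.\<close>

definition rot90 :: "real^2 \<Rightarrow> real^2" where
  "rot90 v = vector [- (v $ 2), v $ 1]"

definition upper_points :: "real^2 \<Rightarrow> real^2 \<Rightarrow> (real^2) set \<Rightarrow> (real^2) set" where
  "upper_points c s0 S = {s \<in> S. (s - c) \<bullet> rot90 (s0 - c) > 0}"

definition polar_angle :: "real^2 \<Rightarrow> real^2 \<Rightarrow> real^2 \<Rightarrow> real" where
  "polar_angle c s0 s = (THE \<theta>. 0 < \<theta> \<and> \<theta> < pi \<and>
     s = c + cos \<theta> *\<^sub>R (s0 - c) + sin \<theta> *\<^sub>R rot90 (s0 - c))"

definition condition_A :: "real^2 \<Rightarrow> real^2 \<Rightarrow> (real^2) set \<Rightarrow> bool" where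
  "condition_A c s0 S \<longleftrightarrow>
     2 * (\<Sum>s \<in> upper_points c s0 S. sin (polar_angle c s0 s / 2)) - 1 \<le> 0"

definition extension :: "real^2 \<Rightarrow> (real^2) set \<Rightarrow> (real^2) set set" where
  "extension s0 S = {insert s0 ((\<lambda>s. s0 + t s *\<^sub>R (s - s0)) ` (S - {s0})) | t.
     \<forall>s \<in> S - {s0}. 0 < t s}"

end

theory Submission
  imports Defs
begin

text \<open>
  Whether a point \<open>p\<close> of a non-collinear set is its Fermat-Weber point depends only on the
  directions in which the other points are seen from \<open>p\<close>. The distance sum is convex; at \<open>p\<close>
  the distances to the other points have a gradient, namely \<open>- u\<close>, where \<open>u\<close> is the sum of the
  unit vectors pointing from \<open>p\<close> to them, and the remaining summand, the distance to \<open>p\<close> itself,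
  has a kink of slope 1 in every direction. Hence \<open>p\<close> is a minimum exactly if \<open>norm u \<le> 1\<close>
  (\<open>fermat_weber_point_eq_iff_norm_sum_sgn\<close>). Sliding the points along their rays from \<open>p\<close> leaves
  \<open>u\<close> unchanged, so all members of the extension, \<open>S\<close> among them, obey the same criterion.

  It remains to compute \<open>u\<close> for \<open>p = s0\<close>. A point \<open>s\<close> of the unit circle and its mirror image have
  equal distance \<open>l\<close> from \<open>s0\<close>, and the two chords issuing from \<open>s0\<close> add up to
  \<open>l\<^sup>2 *\<^sub>R (c - s0)\<close>; the two unit vectors thus add up to \<open>l *\<^sub>R (c - s0)\<close>
  (\<open>sum_sgn_reflection_symmetric\<close>). So \<open>norm u\<close> is the sum of the chord lengths over one halfplane,
  and since a chord of angle \<open>\<theta>\<close> has length \<open>2 * sin (\<theta> / 2)\<close>, the criterion \<open>norm u \<le> 1\<close> is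
  Condition A.
\<close>

section \<open>Minimality at a point of the set\<close>

text \<open>The affine function \<open>q \<mapsto> dist p s - sgn (s - p) \<bullet> (q - p)\<close> supports the distance to \<open>s\<close> from
  below. Summed over \<open>R\<close>, the supports lose at most \<open>norm u * dist q p\<close> between \<open>p\<close> and \<open>q\<close>,
  where \<open>u\<close> is the sum of the unit vectors, and the summand \<open>dist q p\<close> makes up for that.\<close>

lemma sum_dist_minimal_if:
  fixes p q :: "'a::real_inner"
  assumes "norm (\<Sum>s\<in>R. sgn (s - p)) \<le> 1"
  shows "(\<Sum>s\<in>R. dist p s) \<le> dist q p + (\<Sum>s\<in>R. dist q s)"
proof -
  let ?u = "\<Sum>s\<in>R. sgn (s - p)"
  have "dist p s - sgn (s - p) \<bullet> (q - p) \<le> dist q s" for s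
  proof -
    have "dist p s = sgn (s - p) \<bullet> (s - p)"
      unfolding sgn_div_norm dist_norm norm_minus_commute[of p s] inner_scaleR_left
      by (cases "s = p") (simp_all add: field_simps dot_square_norm power2_eq_square)
    then have "dist p s - sgn (s - p) \<bullet> (q - p) = sgn (s - p) \<bullet> (s - q)"
      by (simp add: inner_diff_right)
    also have "\<dots> \<le> norm (sgn (s - p)) * norm (s - q)"
      by (rule norm_cauchy_schwarz)
    also have "\<dots> \<le> dist q s"
      by (simp add: norm_sgn dist_norm norm_minus_commute)
    finally show ?thesis .
  qed
  then have "(\<Sum>s\<in>R. dist p s - sgn (s - p) \<bullet> (q - p)) \<le> (\<Sum>s\<in>R. dist q s)"
    by (rule sum_mono)
  then have "(\<Sum>s\<in>R. dist p s) \<le> ?u \<bullet> (q - p) + (\<Sum>s\<in>R. dist q s)"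
    by (simp add: sum_subtractf inner_sum_left)
  moreover have "?u \<bullet> (q - p) \<le> norm ?u * norm (q - p)"
    by (rule norm_cauchy_schwarz)
  moreover have "norm ?u * norm (q - p) \<le> 1 * dist q p"
    unfolding dist_norm by (rule mult_right_mono[OF assms]) simp
  ultimately show ?thesis by linarith
qed

text \<open>Moving from \<open>p\<close> in the direction of \<open>u\<close>, the sum of the unit vectors, is steepest descent for
  the sum over \<open>R\<close>: the slope is \<open>- (norm u)\<^sup>2\<close>, against \<open>norm u\<close> for the summand \<open>dist q p\<close>. If
  \<open>norm u > 1\<close>, the total decreases.\<close>

lemma sum_dist_minimal_only_if:
  fixes p :: "'a::real_inner"
  assumes pR: "p \<notin> R"
    and min: "\<And>q. (\<Sum>s\<in>R. dist p s) \<le> dist q p + (\<Sum>s\<in>R. dist q s)"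
  shows "norm (\<Sum>s\<in>R. sgn (s - p)) \<le> 1"
proof (rule ccontr)
  define u where "u = (\<Sum>s\<in>R. sgn (s - p))"
  assume "\<not> norm (\<Sum>s\<in>R. sgn (s - p)) \<le> 1"
  then have u1: "norm u > 1" by (simp add: u_def)
  \<comment> \<open>The total along the ray from \<open>p\<close>. Writing \<open>h * norm u\<close> for the distance to \<open>p\<close>, which is
    correct for \<open>h \<ge> 0\<close> only, makes the function differentiable at \<open>0\<close>.\<close>
  define \<phi> where "\<phi> h = h * norm u + (\<Sum>s\<in>R. norm (p + h *\<^sub>R u - s))" for h :: real
  have "((\<lambda>h. norm (p + h *\<^sub>R u - s)) has_real_derivative - (sgn (s - p) \<bullet> u)) (at 0)"
    if "s \<in> R" for s
  proof -
    have ne: "p + 0 *\<^sub>R u - s \<noteq> 0" using that pR by auto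
    have "((\<lambda>h. norm (p + h *\<^sub>R u - s)) has_derivative
        (\<lambda>h. (h *\<^sub>R u) \<bullet> sgn (p + 0 *\<^sub>R u - s))) (at 0)"
      by (rule has_derivative_compose[of "\<lambda>h. p + h *\<^sub>R u - s", OF _ has_derivative_norm[OF ne]])
        (auto intro!: derivative_eq_intros)
    then show ?thesis
      unfolding has_field_derivative_def
      by (rule has_derivative_eq_rhs)
        (use sgn_minus[of "s - p"] in \<open>auto simp: inner_commute fun_eq_iff\<close>)
  qed
  then have "(\<phi> has_real_derivative norm u + (\<Sum>s\<in>R. - (sgn (s - p) \<bullet> u))) (at 0)"
    unfolding \<phi>_def by (auto intro!: derivative_eq_intros)
  moreover have "norm u + (\<Sum>s\<in>R. - (sgn (s - p) \<bullet> u)) = norm u * (1 - norm u)"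
    by (simp add: sum_negf flip: inner_sum_left u_def)
      (simp add: dot_square_norm power2_eq_square right_diff_distrib)
  moreover have "norm u * (1 - norm u) < 0"
    using u1 by (intro mult_pos_neg) auto
  ultimately obtain d where d: "d > 0" "\<And>h. h > 0 \<Longrightarrow> h < d \<Longrightarrow> \<phi> (0 + h) < \<phi> 0"
    using DERIV_neg_dec_right[of \<phi> _ 0] by metis
  have "\<phi> (d / 2) < \<phi> 0" using d(2)[of "d / 2"] d(1) by simp
  then show False
    using min[of "p + (d / 2) *\<^sub>R u"] d(1) by (simp add: \<phi>_def dist_norm)
qed

lemma fermat_weber_point_eq_iff_norm_sum_sgn:
  assumes "finite R" "p \<notin> R" "\<not> collinear (insert p R)"
  shows "fermat_weber_point (insert p R) = p \<longleftrightarrow> norm (\<Sum>s\<in>R. sgn (s - p)) \<le> 1"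
proof -
  have ex1: "\<exists>!x. is_arg_min (distance_sum (insert p R)) (\<lambda>_. True) x"
    using assms by (intro fermat_weber_ex1) auto
  have "fermat_weber_point (insert p R) = p \<longleftrightarrow>
      is_arg_min (distance_sum (insert p R)) (\<lambda>_. True) p"
    unfolding fermat_weber_point_def arg_min_def
    using ex1 by (metis (mono_tags, lifting) someI_ex)
  also have "\<dots> \<longleftrightarrow> (\<forall>q. (\<Sum>s\<in>R. dist p s) \<le> dist q p + (\<Sum>s\<in>R. dist q s))"
    using assms by (simp add: is_arg_min_linorder distance_sum_def)
  also have "\<dots> \<longleftrightarrow> norm (\<Sum>s\<in>R. sgn (s - p)) \<le> 1"
    using sum_dist_minimal_if sum_dist_minimal_only_if[OF assms(2)] by blast
  finally show ?thesis .
qed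

section \<open>Chords of the unit circle\<close>

lemma inner_rot90 [simp]: "v \<bullet> rot90 v = 0" "rot90 v \<bullet> rot90 v = v \<bullet> v"
  by (simp_all add: rot90_def inner_vec_def sum_2)

lemma rot90_expansion:
  fixes a w :: "real^2"
  assumes "norm a = 1"
  shows "w = (w \<bullet> a) *\<^sub>R a + (w \<bullet> rot90 a) *\<^sub>R rot90 a"
proof -
  have "a \<bullet> a = 1" using assms by (simp add: dot_square_norm)
  then have "(a$1)^2 + (a$2)^2 = 1"
    by (simp add: inner_vec_def sum_2 power2_eq_square)
  then show ?thesis
    unfolding vec_eq_iff forall_2
    by (simp add: rot90_def inner_vec_def sum_2) algebra
qed

lemma norm_chord_sq:
  fixes a w :: "'a::real_inner"
  assumes "norm a = 1" "norm w = 1"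
  shows "(norm (w - a))\<^sup>2 = 2 * (1 - w \<bullet> a)"
  using assms
  by (simp add: power2_norm_eq_inner norm_eq_1 inner_diff_left inner_diff_right inner_commute[of a w])

text \<open>In the coordinates with axes \<open>a = s0 - c\<close> and \<open>rot90 a\<close>, the point \<open>s\<close> is
  \<open>(cos \<theta>, sin \<theta>)\<close> with \<open>\<theta> = arccos (w \<bullet> a)\<close>, because its second coordinate is positive. The
  half-angle formula then turns the squared chord \<open>2 * (1 - cos \<theta>)\<close> into a square.\<close>

lemma chord_eq_sin_polar_angle:
  fixes c s0 s :: "real^2"
  assumes s0: "s0 \<in> sphere c 1" and s: "s \<in> sphere c 1"
    and up: "(s - c) \<bullet> rot90 (s0 - c) > 0"
  shows "norm (s - s0) = 2 * sin (polar_angle c s0 s / 2)"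
proof -
  define a where "a = s0 - c"
  define w where "w = s - c"
  have na: "norm a = 1" and nw: "norm w = 1"
    using s0 s by (simp_all add: a_def w_def dist_norm norm_minus_commute)
  have aa: "a \<bullet> a = 1" using na by (simp add: dot_square_norm)
  have up': "w \<bullet> rot90 a > 0" using up by (simp add: a_def w_def)
  have w: "w = (w \<bullet> a) *\<^sub>R a + (w \<bullet> rot90 a) *\<^sub>R rot90 a"
    by (rule rot90_expansion[OF na])
  have "1 = w \<bullet> w" using nw by (simp add: dot_square_norm)
  also have "\<dots> = (w \<bullet> a)\<^sup>2 + (w \<bullet> rot90 a)\<^sup>2"
    by (subst (2) w) (simp add: inner_add_right power2_eq_square)
  finally have sq: "(w \<bullet> a)\<^sup>2 + (w \<bullet> rot90 a)\<^sup>2 = 1" by simp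
  define P where "P \<theta> \<longleftrightarrow> 0 < \<theta> \<and> \<theta> < pi \<and>
    s = c + cos \<theta> *\<^sub>R (s0 - c) + sin \<theta> *\<^sub>R rot90 (s0 - c)" for \<theta>
  define \<theta> where "\<theta> = arccos (w \<bullet> a)"
  have "(w \<bullet> a)\<^sup>2 < 1" using sq zero_less_power[OF up', of 2] by linarith
  then have b: "- 1 < w \<bullet> a" "w \<bullet> a < 1"
    using abs_square_less_1[of "w \<bullet> a"] by linarith+
  have cos: "cos \<theta> = w \<bullet> a" unfolding \<theta>_def using b by simp
  have sin: "sin \<theta> = w \<bullet> rot90 a"
  proof -
    have "sin \<theta> = sqrt (1 - (w \<bullet> a)\<^sup>2)"
      unfolding \<theta>_def using b by (simp add: sin_arccos)
    also have "1 - (w \<bullet> a)\<^sup>2 = (w \<bullet> rot90 a)\<^sup>2" using sq by simp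
    finally show ?thesis using up' by simp
  qed
  have "w = cos \<theta> *\<^sub>R a + sin \<theta> *\<^sub>R rot90 a" unfolding cos sin by (rule w)
  then have "s = c + cos \<theta> *\<^sub>R (s0 - c) + sin \<theta> *\<^sub>R rot90 (s0 - c)"
    unfolding a_def w_def by (simp only: diff_eq_eq ac_simps)
  then have "P \<theta>"
    unfolding P_def using arccos_lt_bounded[OF b] by (simp add: \<theta>_def)
  have bounds: "0 < \<theta>'" "\<theta>' < pi" if "P \<theta>'" for \<theta>'
    using that unfolding P_def by blast+
  have cos_P: "cos \<theta>' = w \<bullet> a" if "P \<theta>'" for \<theta>'
  proof -
    have "w = cos \<theta>' *\<^sub>R a + sin \<theta>' *\<^sub>R rot90 a"
      using that unfolding P_def a_def w_def diff_eq_eq by (simp only: ac_simps)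
    then have "w \<bullet> a = (cos \<theta>' *\<^sub>R a + sin \<theta>' *\<^sub>R rot90 a) \<bullet> a" by simp
    then show ?thesis by (simp add: inner_add_left aa inner_commute[of "rot90 a"])
  qed
  have polar: "polar_angle c s0 s = \<theta>"
    unfolding polar_angle_def
  proof (rule the_equality)
    show "0 < \<theta> \<and> \<theta> < pi \<and> s = c + cos \<theta> *\<^sub>R (s0 - c) + sin \<theta> *\<^sub>R rot90 (s0 - c)"
      using \<open>P \<theta>\<close> unfolding P_def .
  next
    fix \<theta>' assume "0 < \<theta>' \<and> \<theta>' < pi \<and> s = c + cos \<theta>' *\<^sub>R (s0 - c) + sin \<theta>' *\<^sub>R rot90 (s0 - c)"
    then have P': "P \<theta>'" unfolding P_def .
    have "cos \<theta>' = cos \<theta>" using cos_P[OF P'] cos_P[OF \<open>P \<theta>\<close>] by simp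
    with bounds[OF P'] bounds[OF \<open>P \<theta>\<close>] show "\<theta>' = \<theta>"
      using cos_inj_pi[of \<theta>' \<theta>] by simp
  qed
  have "(norm (w - a))\<^sup>2 = (2 * sin (\<theta> / 2))\<^sup>2"
    using norm_chord_sq[OF na nw] cos_P[OF \<open>P \<theta>\<close>] cos_double_sin[of "\<theta> / 2"]
    by (simp add: power_mult_distrib)
  moreover have "sin (\<theta> / 2) \<ge> 0"
    using bounds[OF \<open>P \<theta>\<close>] by (intro sin_ge_zero) auto
  ultimately have "norm (w - a) = 2 * sin (\<theta> / 2)"
    by (intro power2_eq_imp_eq[of "norm (w - a)"]) simp_all
  moreover have "w - a = s - s0" by (simp add: a_def w_def)
  ultimately show ?thesis using polar by simp
qed

text \<open>Here \<open>v\<close> is the mirror image of \<open>w\<close> about the line spanned by \<open>a\<close>: the components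
  orthogonal to \<open>a\<close> cancel in the sum of the two chords, and the component along \<open>a\<close> is
  \<open>2 * (w \<bullet> a - 1)\<close>, minus the squared chord.\<close>

lemma reflected_chord:
  fixes a w :: "'a::real_inner"
  assumes na: "norm a = 1" and nw: "norm w = 1"
  defines "v \<equiv> (2 * (w \<bullet> a)) *\<^sub>R a - w"
  shows "(w - a) + (v - a) = - ((norm (w - a))\<^sup>2 *\<^sub>R a)"
    and "norm (v - a) = norm (w - a)"
    and "v \<bullet> a = w \<bullet> a"
proof -
  have aa: "a \<bullet> a = 1" and ww: "w \<bullet> w = 1" using na nw by (simp_all add: dot_square_norm)
  show va: "v \<bullet> a = w \<bullet> a" by (simp add: v_def inner_diff_left aa)
  have "v \<bullet> v = 1"
    by (simp add: v_def inner_diff_left inner_diff_right aa ww inner_commute[of a w])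
  then have nv: "norm v = 1" by (simp add: norm_eq_sqrt_inner)
  show "(w - a) + (v - a) = - ((norm (w - a))\<^sup>2 *\<^sub>R a)"
    unfolding norm_chord_sq[OF na nw] by (simp add: v_def algebra_simps scaleR_2)
  have "(norm (v - a))\<^sup>2 = (norm (w - a))\<^sup>2"
    unfolding norm_chord_sq[OF na nw] norm_chord_sq[OF na nv] va ..
  then show "norm (v - a) = norm (w - a)"
    by (rule power2_eq_imp_eq) simp_all
qed

lemma chord_add_reflected_chord:
  assumes s0: "s0 \<in> sphere c 1" and s: "s \<in> sphere c 1"
  shows "(s - s0) + (reflect_about c s0 s - s0) = (norm (s - s0))\<^sup>2 *\<^sub>R (c - s0)"
    and "norm (reflect_about c s0 s - s0) = norm (s - s0)"
    and "(reflect_about c s0 s - c) \<bullet> rot90 (s0 - c) = - ((s - c) \<bullet> rot90 (s0 - c))"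
    and "reflect_about c s0 (reflect_about c s0 s) = s"
proof -
  define a where "a = s0 - c"
  define w where "w = s - c"
  define v where "v = (2 * (w \<bullet> a)) *\<^sub>R a - w"
  have na: "norm a = 1" and nw: "norm w = 1"
    using s0 s by (simp_all add: a_def w_def dist_norm norm_minus_commute)
  have aa: "a \<bullet> a = 1" using na by (simp add: dot_square_norm)
  have refl_eq: "reflect_about c s0 x = c + ((2 * ((x - c) \<bullet> a)) *\<^sub>R a - (x - c))" for x
    using aa by (simp add: reflect_about_def a_def)
  have r: "reflect_about c s0 s = c + v"
    unfolding refl_eq v_def w_def ..
  have rc: "reflect_about c s0 s - s0 = v - a" "s - s0 = w - a" "c - s0 = - a"
    by (simp_all add: r a_def w_def)
  note chord = reflected_chord[OF na nw, folded v_def]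
  show "(s - s0) + (reflect_about c s0 s - s0) = (norm (s - s0))\<^sup>2 *\<^sub>R (c - s0)"
    unfolding rc chord(1) by simp
  show "norm (reflect_about c s0 s - s0) = norm (s - s0)"
    unfolding rc by (rule chord(2))
  show "(reflect_about c s0 s - c) \<bullet> rot90 (s0 - c) = - ((s - c) \<bullet> rot90 (s0 - c))"
    unfolding r a_def[symmetric] w_def[symmetric] by (simp add: v_def inner_diff_left)
  have "reflect_about c s0 (reflect_about c s0 s) = c + ((2 * (v \<bullet> a)) *\<^sub>R a - v)"
    unfolding r refl_eq[of "c + v"] by simp
  also have "\<dots> = s"
    unfolding chord(3) by (simp add: v_def w_def)
  finally show "reflect_about c s0 (reflect_about c s0 s) = s" .
qed

text \<open>A ray starting at a point \<open>a\<close> of the unit sphere meets the sphere in at most one further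
  point. By \<open>norm_chord_sq\<close> the component of \<open>v - a\<close> along \<open>a\<close> is quadratic in \<open>norm (v - a)\<close>, so
  the direction determines the length of the chord.\<close>

lemma chord_directions_injective:
  fixes a v w :: "'a::real_inner"
  assumes n: "norm a = 1" "norm v = 1" "norm w = 1" and ne: "v \<noteq> a" "w \<noteq> a"
    and t: "t > 0" "t' > 0" and eq: "t *\<^sub>R (v - a) = t' *\<^sub>R (w - a)"
  shows "v = w"
proof -
  have proj: "(x - a) \<bullet> a = - ((norm (x - a))\<^sup>2 / 2)" if "norm x = 1" for x
    unfolding norm_chord_sq[OF n(1) that] using n(1)
    by (simp add: inner_diff_left dot_square_norm field_simps)
  have len: "t * norm (v - a) = t' * norm (w - a)"
    using arg_cong[OF eq, of norm] t by simp
  have "t * (norm (v - a))\<^sup>2 = t' * (norm (w - a))\<^sup>2"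
    using arg_cong[OF eq, of "\<lambda>x. x \<bullet> a"] by (simp add: proj n)
  then have "(t * norm (v - a)) * norm (v - a) = (t' * norm (w - a)) * norm (w - a)"
    by (simp add: power2_eq_square mult.assoc)
  then have "norm (v - a) = norm (w - a)" using len t ne by simp
  then have "t = t'" using len ne by simp
  then show ?thesis using eq t by simp
qed

section \<open>Reflection symmetric sets\<close>

lemma mem_affine_hull_2I:
  fixes x y z :: "'a::real_vector"
  assumes "z - x = t *\<^sub>R (y - x)"
  shows "z \<in> affine hull {x, y}"
proof -
  have "z = (1 - t) *\<^sub>R x + t *\<^sub>R y"
    using assms by (simp add: diff_eq_eq scaleR_diff_left scaleR_diff_right)
  moreover have "(1 - t) + t = 1" by simp
  ultimately show ?thesis unfolding affine_hull_2 by blast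
qed

lemma sum_sgn_reflection_symmetric:
  assumes rs: "reflection_symmetric c s0 S"
  shows "(\<Sum>s\<in>S - {s0}. sgn (s - s0)) = (\<Sum>s\<in>upper_points c s0 S. norm (s - s0)) *\<^sub>R (c - s0)"
proof -
  let ?r = "reflect_about c s0" and ?h = "\<lambda>s. (s - c) \<bullet> rot90 (s0 - c)"
  let ?U = "upper_points c s0 S" and ?L = "{s \<in> S. ?h s < 0}"
  from rs obtain m where cm: "card S = 2 * m + 1" by (auto simp: reflection_symmetric_def)
  then have fin: "finite S" using card.infinite by fastforce
  from rs have sph: "S \<subseteq> sphere c 1" and s0: "s0 \<in> S"
    and off: "\<And>s. s \<in> S - {s0} \<Longrightarrow> s \<notin> affine hull {c, s0}"
    and mirror: "\<And>s. s \<in> S - {s0} \<Longrightarrow> ?r s \<in> S - {s0, s}"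
    by (auto simp: reflection_symmetric_def)
  have s0c: "s0 \<in> sphere c 1" using s0 sph by blast
  have na: "norm (s0 - c) = 1" using s0c by (simp add: dist_norm norm_minus_commute)
  note chord = chord_add_reflected_chord[OF s0c subsetD[OF sph]]
  have h0: "?h s \<noteq> 0" if "s \<in> S - {s0}" for s
  proof
    assume "?h s = 0"
    then have "s - c = ((s - c) \<bullet> (s0 - c)) *\<^sub>R (s0 - c)"
      using rot90_expansion[OF na, of "s - c"] by (metis add_0_right scaleR_zero_left)
    then have "s \<in> affine hull {c, s0}" by (rule mem_affine_hull_2I)
    with off[OF that] show False ..
  qed
  have U: "?U \<subseteq> S - {s0}" and L: "?L \<subseteq> S - {s0}"
    by (auto simp: upper_points_def)
  \<comment> \<open>No point of \<open>S\<close> other than \<open>s0\<close> lies on the axis, so the two open halfplanes contain the rest.\<close>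
  have split: "S - {s0} = ?U \<union> ?L"
    using U L h0 by (fastforce simp: upper_points_def)
  have disj: "?U \<inter> ?L = {}" by (auto simp: upper_points_def)
  have bij: "bij_betw ?r ?U ?L"
  proof (rule bij_betw_byWitness[where f' = ?r])
    show "\<forall>s\<in>?U. ?r (?r s) = s" "\<forall>s\<in>?L. ?r (?r s) = s"
      using chord(4) by (auto simp: upper_points_def)
    show "?r ` ?U \<subseteq> ?L" "?r ` ?L \<subseteq> ?U"
      using U L mirror chord(3) by (fastforce simp: upper_points_def)+
  qed
  have "(\<Sum>s\<in>S - {s0}. sgn (s - s0)) = (\<Sum>s\<in>?U. sgn (s - s0)) + (\<Sum>s\<in>?L. sgn (s - s0))"
    unfolding split using fin disj by (intro sum.union_disjoint) (auto simp: upper_points_def)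
  also have "(\<Sum>s\<in>?L. sgn (s - s0)) = (\<Sum>s\<in>?U. sgn (?r s - s0))"
    by (rule sum.reindex_bij_betw[OF bij, symmetric])
  also have "(\<Sum>s\<in>?U. sgn (s - s0)) + \<dots> = (\<Sum>s\<in>?U. norm (s - s0) *\<^sub>R (c - s0))"
    unfolding sum.distrib[symmetric]
  proof (rule sum.cong[OF refl])
    fix s assume "s \<in> ?U"
    with U have s: "s \<in> S" "s \<noteq> s0" by auto
    have "sgn (s - s0) + sgn (?r s - s0) = inverse (norm (s - s0)) *\<^sub>R ((s - s0) + (?r s - s0))"
      unfolding sgn_div_norm chord(2)[OF s(1)] by (rule scaleR_add_right[symmetric])
    also have "\<dots> = norm (s - s0) *\<^sub>R (c - s0)"
      using s(2) by (simp add: chord(1)[OF s(1)] power2_eq_square)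
    finally show "sgn (s - s0) + sgn (?r s - s0) = norm (s - s0) *\<^sub>R (c - s0)" .
  qed
  finally show ?thesis by (simp add: scaleR_left.sum)
qed

lemma norm_sum_sgn_le_1_iff_condition_A:
  assumes rs: "reflection_symmetric c s0 S"
  shows "norm (\<Sum>s\<in>S - {s0}. sgn (s - s0)) \<le> 1 \<longleftrightarrow> condition_A c s0 S"
proof -
  from rs have sph: "S \<subseteq> sphere c 1" and s0: "s0 \<in> S"
    by (auto simp: reflection_symmetric_def)
  have "norm (c - s0) = 1" using s0 sph by (auto simp: dist_norm)
  then have "norm (\<Sum>s\<in>S - {s0}. sgn (s - s0)) = (\<Sum>s\<in>upper_points c s0 S. norm (s - s0))"
    unfolding sum_sgn_reflection_symmetric[OF rs] by (simp add: sum_nonneg)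
  also have "\<dots> = (\<Sum>s\<in>upper_points c s0 S. 2 * sin (polar_angle c s0 s / 2))"
    using sph s0 by (intro sum.cong refl chord_eq_sin_polar_angle) (auto simp: upper_points_def)
  also have "\<dots> = 2 * (\<Sum>s\<in>upper_points c s0 S. sin (polar_angle c s0 s / 2))"
    by (simp add: sum_distrib_left)
  finally show ?thesis by (simp add: condition_A_def)
qed

text \<open>If the moved points and \<open>s0\<close> were on a line, a point \<open>s\<close> and its mirror image would be on the
  same line through \<open>s0\<close>. The sum of their chords is a nonzero multiple of \<open>c - s0\<close>, so that
  line would be the axis, which contains no point of \<open>S\<close> besides \<open>s0\<close>.\<close>

lemma not_collinear_extension:
  assumes rs: "reflection_symmetric c s0 S" and t: "\<And>s. s \<in> S - {s0} \<Longrightarrow> 0 < t s"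
  shows "\<not> collinear (insert s0 ((\<lambda>s. s0 + t s *\<^sub>R (s - s0)) ` (S - {s0})))" (is "\<not> collinear ?T")
proof
  assume col: "collinear ?T"
  let ?r = "reflect_about c s0"
  from rs obtain m where m: "m \<ge> 1" "card S = 2 * m + 1"
    and sph: "S \<subseteq> sphere c 1" and s0: "s0 \<in> S"
    by (auto simp: reflection_symmetric_def)
  have "S - {s0} \<noteq> {}"
  proof
    assume "S - {s0} = {}"
    then have "S = {s0}" using s0 by blast
    then show False using m by simp
  qed
  then obtain s where s: "s \<in> S - {s0}" by blast
  with rs have off: "s \<notin> affine hull {c, s0}" and r: "?r s \<in> S - {s0}"
    by (auto simp: reflection_symmetric_def)
  from col obtain u where u: "\<And>x y. x \<in> ?T \<Longrightarrow> y \<in> ?T \<Longrightarrow> \<exists>k. x - y = k *\<^sub>R u"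
    unfolding collinear_def by blast
  have "\<exists>k. x - s0 = k *\<^sub>R u" if x: "x \<in> S - {s0}" for x
  proof -
    have "s0 + t x *\<^sub>R (x - s0) \<in> ?T" using x by blast
    from u[OF this insertI1] obtain k where "t x *\<^sub>R (x - s0) = k *\<^sub>R u" by auto
    then have "x - s0 = (k / t x) *\<^sub>R u"
      using t[OF x] by (simp add: eq_vector_fraction_iff)
    then show ?thesis ..
  qed
  from this[OF s] this[OF r] obtain k l
    where k: "s - s0 = k *\<^sub>R u" and l: "?r s - s0 = l *\<^sub>R u" by blast
  have "(k + l) *\<^sub>R u = (norm (s - s0))\<^sup>2 *\<^sub>R (c - s0)"
    using chord_add_reflected_chord(1)[OF subsetD[OF sph s0] subsetD[OF sph DiffD1[OF s]]]
    unfolding k l by (simp only: scaleR_add_left)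
  moreover have "c - s0 \<noteq> 0" using s0 sph by auto
  moreover have "norm (s - s0) \<noteq> 0" using s by simp
  ultimately have kl: "k + l \<noteq> 0" "u = ((norm (s - s0))\<^sup>2 / (k + l)) *\<^sub>R (c - s0)"
    by (auto simp: eq_vector_fraction_iff)
  define j where "j = k * ((norm (s - s0))\<^sup>2 / (k + l))"
  have "k *\<^sub>R u = j *\<^sub>R (c - s0)"
    unfolding j_def by (subst kl(2)) (simp only: scaleR_scaleR)
  with k have "s - s0 = j *\<^sub>R (c - s0)" by (rule trans)
  then have "s \<in> affine hull {s0, c}" by (rule mem_affine_hull_2I)
  then have "s \<in> affine hull {c, s0}" by (simp only: insert_commute)
  with off show False ..
qed

text \<open>Moving a point along its ray does not change the unit vector pointing to it. The sum over the
  moved set can be compared with the sum over \<open>S\<close> because distinct points stay distinct: they lie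
  on distinct rays.\<close>

lemma fermat_weber_point_extension_iff:
  assumes rs: "reflection_symmetric c s0 S" and T: "T \<in> extension s0 S"
  shows "fermat_weber_point T = s0 \<longleftrightarrow> condition_A c s0 S"
proof -
  from T obtain t where t: "\<And>s. s \<in> S - {s0} \<Longrightarrow> 0 < t s"
    and T: "T = insert s0 ((\<lambda>s. s0 + t s *\<^sub>R (s - s0)) ` (S - {s0}))"
    unfolding extension_def by blast
  let ?g = "\<lambda>s. s0 + t s *\<^sub>R (s - s0)"
  from rs have sph: "S \<subseteq> sphere c 1" and s0: "s0 \<in> S" and "card S \<noteq> 0"
    by (auto simp: reflection_symmetric_def)
  then have fin: "finite S" by (metis card.infinite)
  have unit: "norm (s - c) = 1" if "s \<in> S" for s
    using that sph by (auto simp: dist_norm norm_minus_commute)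
  have inj: "inj_on ?g (S - {s0})"
  proof (rule inj_onI)
    fix x y assume x: "x \<in> S - {s0}" and y: "y \<in> S - {s0}" and "?g x = ?g y"
    then have "t x *\<^sub>R ((x - c) - (s0 - c)) = t y *\<^sub>R ((y - c) - (s0 - c))" by simp
    then have "x - c = y - c"
      by (rule chord_directions_injective[rotated -1]) (use x y s0 unit t in auto)
    then show "x = y" by simp
  qed
  have "fermat_weber_point T = s0 \<longleftrightarrow> norm (\<Sum>x\<in>?g ` (S - {s0}). sgn (x - s0)) \<le> 1"
    unfolding T
  proof (rule fermat_weber_point_eq_iff_norm_sum_sgn)
    show "s0 \<notin> ?g ` (S - {s0})" using t by fastforce
  qed (use fin not_collinear_extension[OF rs t] in auto)
  also have "(\<Sum>x\<in>?g ` (S - {s0}). sgn (x - s0)) = (\<Sum>s\<in>S - {s0}. sgn (s - s0))"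
    unfolding sum.reindex[OF inj] using t by (intro sum.cong) (auto simp: sgn_scaleR)
  finally show ?thesis
    using norm_sum_sgn_le_1_iff_condition_A[OF rs] by simp
qed

theorem theorem4:
  fixes S :: "(real^2) set" and c s0 :: "real^2" and k :: nat
  assumes "reflection_symmetric c s0 S"
    and "card S = k" and "k \<ge> 3"
  shows "(\<forall>T \<in> extension s0 S. fermat_weber_point T = s0 \<longleftrightarrow> fermat_weber_point S = s0) \<and>
         (fermat_weber_point S = s0 \<longleftrightarrow> condition_A c s0 S)"
proof -
  \<comment> \<open>\<open>S\<close> belongs to its own extension, so the criterion for the extension covers it too.\<close>
  have "s0 \<in> S" using assms(1) by (simp add: reflection_symmetric_def)
  then have "S = insert s0 ((\<lambda>s. s0 + 1 *\<^sub>R (s - s0)) ` (S - {s0}))" by auto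
  then have "S \<in> extension s0 S"
    unfolding extension_def mem_Collect_eq by (intro exI[of _ "\<lambda>_. 1"]) simp
  then show ?thesis
    using fermat_weber_point_extension_iff[OF assms(1)] by blast
qed

end
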